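(* Let $k\geq 3$ be an integer such that $2k=p^{\alpha}+1\equiv 2 \pmod 4$ for some prime $p$ and non-negative integer $\alpha$. Then there exists a $(2k,k)$ complex equiangular tight frame.
   Context: An $(N,r)$ frame is a Parseval frame of $N$ vectors $f_1,\dots,f_N$ in $\mathbb{C}^r$ with the usual inner product, i.e. $\sum_{i=1}^N|\langle x,f_i\rangle|^2=\|x\|^2$ for all $x\in\mathbb{C}^r$. An $(N,r)$ complex equiangular tight frame (CETF) is an $(N,r)$ frame such that $\|f_i\|$ is the same for all $i$ and $|\langle f_i,f_j\rangle|$ is the same for all $i\neq j$. *)

theory Defs
  imports Complex_Main "HOL-Computational_Algebra.Primes"
begin

text \<open>Vectors of C^r are represented as functions nat => complex, of which only
the coordinates 0..r-1 are used. Frame vectors are indexed by 0..N-1.\<close>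

definition cinner :: "nat \<Rightarrow> (nat \<Rightarrow> complex) \<Rightarrow> (nat \<Rightarrow> complex) \<Rightarrow> complex" where
  "cinner r x y = (\<Sum>j<r. x j * cnj (y j))"

definition cvnorm :: "nat \<Rightarrow> (nat \<Rightarrow> complex) \<Rightarrow> real" where
  "cvnorm r x = sqrt (\<Sum>j<r. (cmod (x j))\<^sup>2)"

definition parseval_frame :: "nat \<Rightarrow> nat \<Rightarrow> (nat \<Rightarrow> nat \<Rightarrow> complex) \<Rightarrow> bool" where
  "parseval_frame N r f \<longleftrightarrow>
     (\<forall>x. (\<Sum>i<N. (cmod (cinner r x (f i)))\<^sup>2) = (cvnorm r x)\<^sup>2)"

definition CETF :: "nat \<Rightarrow> nat \<Rightarrow> (nat \<Rightarrow> nat \<Rightarrow> complex) \<Rightarrow> bool" where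
  "CETF N r f \<longleftrightarrow> parseval_frame N r f
     \<and> (\<exists>c. \<forall>i<N. cvnorm r (f i) = c)
     \<and> (\<exists>d. \<forall>i<N. \<forall>j<N. i \<noteq> j \<longrightarrow> cmod (cinner r (f i) (f j)) = d)"

end

theory Submission
  imports Defs "HOL-Number_Theory.Cong" "Jordan_Normal_Form.Char_Poly"
begin

text \<open>
  Let \<open>q = 2k - 1\<close>, let \<open>F\<close> be the field with \<open>q\<close> elements, \<open>\<chi>\<close> a nontrivial additive character of \<open>F\<close>
  and \<open>S\<close> the set of its \<open>k - 1\<close> nonzero squares. The frame consists of the vectors
  \<open>(1 / sqrt (2q), (\<chi>(x s) / sqrt q) for s in S)\<close> for \<open>x\<close> in \<open>F\<close>, together with \<open>(1 / sqrt 2, 0, \<dots>, 0)\<close>.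
  Orthogonality of characters gives the Parseval property. The inner product of the vectors of
  \<open>x\<close> and \<open>y\<close> is \<open>1 / (2q)\<close> times the Gauss sum of \<open>\<chi>((x - y) z\<^sup>2)\<close> over \<open>z\<close> in \<open>F\<close>,
  whose modulus is \<open>sqrt q\<close>.

  The field is realised as \<open>\<int>[\<zeta>] / M\<close>, where \<open>\<zeta>\<close> is a primitive complex \<open>(q - 1)\<close>-th root of unity
  and \<open>M\<close> is a maximal ideal containing \<open>p\<close>; it exists because \<open>1 / p\<close> is not an algebraic integer.
  Since \<open>x\<^sup>q - x\<close> lies in \<open>M\<close> for all \<open>x\<close> and factors over the numbers 0 and \<open>\<zeta>\<^sup>i\<close>, these \<open>q\<close> numbers
  represent all residue classes. The quotient is never formed: sums run over these representatives.
\<close>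

section \<open>Maximal submodules\<close>

text \<open>The ring is a set inside a type so that one Zorn argument serves twice: for the
  cyclotomic ring it yields a maximal ideal, for \<open>\<int>\<close> a maximal additive
  subgroup.\<close>

locale comm_subring =
  fixes R :: "'a::comm_ring_1 set"
  assumes one_closed: "1 \<in> R"
    and diff_closed: "x \<in> R \<Longrightarrow> y \<in> R \<Longrightarrow> x - y \<in> R"
    and mult_closed: "x \<in> R \<Longrightarrow> y \<in> R \<Longrightarrow> x * y \<in> R"
begin

lemma zero_closed: "0 \<in> R"
  using diff_closed[OF one_closed one_closed] by simp

lemma uminus_closed: "x \<in> R \<Longrightarrow> - x \<in> R"
  using diff_closed[OF zero_closed] by fastforce

lemma add_closed: "x \<in> R \<Longrightarrow> y \<in> R \<Longrightarrow> x + y \<in> R"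
  using diff_closed[of x "- y"] uminus_closed by simp

lemma power_closed: "x \<in> R \<Longrightarrow> x ^ n \<in> R"
  by (induction n) (auto intro: one_closed mult_closed)

lemma of_nat_closed: "of_nat n \<in> R"
  by (induction n) (auto intro: one_closed zero_closed add_closed)

lemma of_int_closed: "of_int n \<in> R"
  by (cases n) (auto intro: of_nat_closed uminus_closed simp flip: of_nat_Suc simp del: of_nat_Suc)

lemma sum_closed: "(\<And>i. i \<in> A \<Longrightarrow> f i \<in> R) \<Longrightarrow> sum f A \<in> R"
  by (induction A rule: infinite_finite_induct) (auto intro: zero_closed add_closed)

end

text \<open>Containment of \<open>M\<close> in \<open>R\<close> is not demanded, so that an ideal of
  the cyclotomic ring can also be regarded as a module over \<open>\<int>\<close>.\<close>

definition submodule_over :: "'a::comm_ring_1 set \<Rightarrow> 'a set \<Rightarrow> bool" where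
  "submodule_over R M \<longleftrightarrow> 0 \<in> M \<and> (\<forall>x\<in>M. \<forall>y\<in>M. x - y \<in> M) \<and> (\<forall>r\<in>R. \<forall>x\<in>M. r * x \<in> M)"

lemma
  assumes "submodule_over R M"
  shows submodule_zero: "0 \<in> M"
    and submodule_diff: "x \<in> M \<Longrightarrow> y \<in> M \<Longrightarrow> x - y \<in> M"
    and submodule_scale: "r \<in> R \<Longrightarrow> x \<in> M \<Longrightarrow> r * x \<in> M"
    and submodule_uminus: "x \<in> M \<Longrightarrow> - x \<in> M"
    and submodule_add: "x \<in> M \<Longrightarrow> y \<in> M \<Longrightarrow> x + y \<in> M"
proof -
  show z: "0 \<in> M" and d: "x \<in> M \<Longrightarrow> y \<in> M \<Longrightarrow> x - y \<in> M" for x y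
    using assms by (auto simp: submodule_over_def)
  show "r \<in> R \<Longrightarrow> x \<in> M \<Longrightarrow> r * x \<in> M"
    using assms by (auto simp: submodule_over_def)
  show u: "x \<in> M \<Longrightarrow> - x \<in> M" for x
    using d[OF z] by fastforce
  show "x \<in> M \<Longrightarrow> y \<in> M \<Longrightarrow> x + y \<in> M"
    using d[OF _ u, of x y] by simp
qed

lemma submodule_sum:
  assumes "submodule_over R M" "\<And>i. i \<in> A \<Longrightarrow> f i \<in> M"
  shows "sum f A \<in> M"
  using assms(2)
  by (induction A rule: infinite_finite_induct)
     (auto intro: submodule_zero[OF assms(1)] submodule_add[OF assms(1)])

lemma (in comm_subring) submodule_adjoin:
  assumes M: "submodule_over R M"
  shows "submodule_over R {m + r * x |m r. m \<in> M \<and> r \<in> R}" (is "submodule_over R ?J")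
  unfolding submodule_over_def
proof (intro conjI ballI)
  show "0 \<in> ?J"
    using submodule_zero[OF M] zero_closed by force
next
  fix a b assume "a \<in> ?J" "b \<in> ?J"
  then obtain m r m' r' where "a = m + r * x" "b = m' + r' * x" "m \<in> M" "r \<in> R" "m' \<in> M" "r' \<in> R"
    by blast
  then have "a - b = (m - m') + (r - r') * x" "m - m' \<in> M" "r - r' \<in> R"
    using submodule_diff[OF M] diff_closed by (auto simp: algebra_simps)
  then show "a - b \<in> ?J" by blast
next
  fix s a assume "s \<in> R" "a \<in> ?J"
  then obtain m r where "a = m + r * x" "m \<in> M" "r \<in> R"
    by blast
  then have "s * a = s * m + (s * r) * x" "s * m \<in> M" "s * r \<in> R"
    using submodule_scale[OF M] mult_closed \<open>s \<in> R\<close> by (auto simp: distrib_left mult.assoc)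
  then show "s * a \<in> ?J" by blast
qed

text \<open>Zorn's lemma for submodules that avoid 1. If \<open>x\<close> is outside a maximal one,
  adjoining the multiples of \<open>x\<close> must capture 1, which gives an inverse of
  \<open>x\<close> modulo \<open>M\<close>.\<close>

lemma (in comm_subring) exists_maximal_submodule:
  assumes I: "submodule_over R I" "1 \<notin> I"
  obtains M where "submodule_over R M" "I \<subseteq> M" "1 \<notin> M" "\<And>x. x \<notin> M \<Longrightarrow> \<exists>r\<in>R. r * x - 1 \<in> M"
proof -
  let ?A = "{M. submodule_over R M \<and> I \<subseteq> M \<and> 1 \<notin> M}"
  have "\<exists>M\<in>?A. \<forall>X\<in>?A. M \<subseteq> X \<longrightarrow> X = M"
  proof (rule subset_Zorn_nonempty)
    show "?A \<noteq> {}" using I by blast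
    fix C assume C: "C \<noteq> {}" "subset.chain ?A C"
    then have sub: "submodule_over R X" "I \<subseteq> X" "1 \<notin> X" if "X \<in> C" for X
      using that by (auto simp: subset.chain_def)
    have lin: "X \<subseteq> Y \<or> Y \<subseteq> X" if "X \<in> C" "Y \<in> C" for X Y
      using C(2) that by (auto simp: subset_chain_def)
    have "submodule_over R (\<Union>C)"
      unfolding submodule_over_def
    proof (intro conjI ballI)
      show "0 \<in> \<Union>C" using C(1) sub submodule_zero by blast
    next
      fix x y assume "x \<in> \<Union>C" "y \<in> \<Union>C"
      then obtain X where "X \<in> C" "x \<in> X" "y \<in> X" using lin by blast
      then show "x - y \<in> \<Union>C" using submodule_diff[OF sub(1)] by blast
    next
      fix r x assume "r \<in> R" "x \<in> \<Union>C"
      then show "r * x \<in> \<Union>C" using submodule_scale[OF sub(1)] by blast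
    qed
    then show "\<Union>C \<in> ?A" using sub C(1) by blast
  qed
  then obtain M where M: "submodule_over R M" "I \<subseteq> M" "1 \<notin> M"
    and max: "\<And>X. submodule_over R X \<Longrightarrow> I \<subseteq> X \<Longrightarrow> 1 \<notin> X \<Longrightarrow> M \<subseteq> X \<Longrightarrow> X = M"
    by auto
  have "\<exists>r\<in>R. r * x - 1 \<in> M" if x: "x \<notin> M" for x
  proof -
    let ?J = "{m + r * x |m r. m \<in> M \<and> r \<in> R}"
    have MJ: "M \<subseteq> ?J" using zero_closed by force
    have "x \<in> ?J" using submodule_zero[OF M(1)] one_closed by force
    then have "1 \<in> ?J"
      using max[OF submodule_adjoin[OF M(1), of x]] MJ M(2) x by blast
    then obtain m r where "1 = m + r * x" "m \<in> M" "r \<in> R" by blast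
    moreover from this have "r * x - 1 = - m" by (simp add: algebra_simps)
    ultimately show ?thesis using submodule_uminus[OF M(1), of m] by metis
  qed
  with M that show ?thesis by blast
qed

section \<open>Character sums over a residue system\<close>

text \<open>\<open>M\<close> need not be contained in \<open>R\<close>; only its trace on \<open>R\<close> matters.\<close>
locale residue_system = comm_subring R
  for R :: "'a::comm_ring_1 set" +
  fixes M :: "'a set" and t :: "nat \<Rightarrow> 'a" and q :: nat
  assumes submod: "submodule_over R M"
    and prime_mod: "x \<in> R \<Longrightarrow> y \<in> R \<Longrightarrow> x * y \<in> M \<Longrightarrow> x \<in> M \<or> y \<in> M"
    and t_closed: "i < q \<Longrightarrow> t i \<in> R"
    and t_cover: "x \<in> R \<Longrightarrow> \<exists>i<q. x - t i \<in> M"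
    and t_distinct: "i < q \<Longrightarrow> j < q \<Longrightarrow> t i - t j \<in> M \<Longrightarrow> i = j"
begin

text \<open>Sending \<open>i\<close> to the index of the representative of \<open>\<sigma> i\<close>
  is injective on a finite set, hence a permutation. This replaces a change of variable in the
  residue field.\<close>

lemma sum_reindex_mod:
  fixes \<phi> :: "'a \<Rightarrow> complex"
  assumes \<phi>: "\<And>x y. x \<in> R \<Longrightarrow> y \<in> R \<Longrightarrow> x - y \<in> M \<Longrightarrow> \<phi> x = \<phi> y"
    and \<sigma>: "\<And>i. i < q \<Longrightarrow> \<sigma> i \<in> R"
    and inj: "\<And>i j. i < q \<Longrightarrow> j < q \<Longrightarrow> \<sigma> i - \<sigma> j \<in> M \<Longrightarrow> i = j"
  shows "(\<Sum>i<q. \<phi> (\<sigma> i)) = (\<Sum>i<q. \<phi> (t i))"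
proof -
  have "\<forall>i\<in>{..<q}. \<exists>j. j < q \<and> \<sigma> i - t j \<in> M"
    using t_cover \<sigma> by blast
  then obtain h where h: "\<And>i. i < q \<Longrightarrow> h i < q" "\<And>i. i < q \<Longrightarrow> \<sigma> i - t (h i) \<in> M"
    by (metis lessThan_iff)
  have "inj_on h {..<q}"
  proof (rule inj_onI)
    fix i j assume ij: "i \<in> {..<q}" "j \<in> {..<q}" "h i = h j"
    then have "(\<sigma> i - t (h i)) - (\<sigma> j - t (h j)) \<in> M"
      using submodule_diff[OF submod h(2)[of i] h(2)[of j]] by simp
    then have "\<sigma> i - \<sigma> j \<in> M" using ij by simp
    then show "i = j" using inj ij by auto
  qed
  moreover have "h ` {..<q} \<subseteq> {..<q}" using h by auto
  ultimately have "bij_betw h {..<q} {..<q}"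
    by (simp add: bij_betw_def endo_inj_surj)
  then have "(\<Sum>i<q. \<phi> (t (h i))) = (\<Sum>i<q. \<phi> (t i))"
    by (rule sum.reindex_bij_betw)
  moreover have "(\<Sum>i<q. \<phi> (\<sigma> i)) = (\<Sum>i<q. \<phi> (t (h i)))"
    by (rule sum.cong) (auto intro!: \<phi> \<sigma> t_closed h)
  ultimately show ?thesis by simp
qed

end

locale residue_character = residue_system R M t q
  for R :: "'a::comm_ring_1 set" and M t q +
  fixes \<chi> :: "'a \<Rightarrow> complex"
  assumes chi_add: "x \<in> R \<Longrightarrow> y \<in> R \<Longrightarrow> \<chi> (x + y) = \<chi> x * \<chi> y"
    and chi_mod: "x \<in> R \<Longrightarrow> x \<in> M \<Longrightarrow> \<chi> x = 1"
    and cmod_chi: "x \<in> R \<Longrightarrow> cmod (\<chi> x) = 1"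
    and chi_one: "\<chi> 1 \<noteq> 1"
begin

lemma chi_zero: "\<chi> 0 = 1"
  using chi_mod zero_closed submodule_zero[OF submod] by blast

lemma chi_cong: "x \<in> R \<Longrightarrow> y \<in> R \<Longrightarrow> x - y \<in> M \<Longrightarrow> \<chi> x = \<chi> y"
  using chi_add[of "x - y" y] chi_mod[of "x - y"] diff_closed by simp

lemma cnj_chi:
  assumes "x \<in> R" shows "cnj (\<chi> x) = \<chi> (- x)"
proof -
  have "\<chi> x * cnj (\<chi> x) = 1"
    using cmod_chi[OF assms] by (simp add: complex_norm_square[symmetric])
  moreover have "\<chi> x * \<chi> (- x) = 1"
    using chi_add[of x "- x"] assms uminus_closed chi_zero by simp
  ultimately show ?thesis by (metis mult_cancel_left mult_zero_left zero_neq_one)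
qed

lemma chi_mult_cnj: "x \<in> R \<Longrightarrow> y \<in> R \<Longrightarrow> \<chi> x * cnj (\<chi> y) = \<chi> (x - y)"
  using chi_add[of x "- y"] by (simp add: cnj_chi uminus_closed)

text \<open>Translation by 1 permutes the residue classes and multiplies the sum by
  \<open>\<chi> 1\<close>, which differs from 1.\<close>

lemma sum_chi: "(\<Sum>i<q. \<chi> (t i)) = 0"
proof -
  have "(\<Sum>i<q. \<chi> (t i)) = (\<Sum>i<q. \<chi> (t i + 1))"
    by (rule sum_reindex_mod[OF chi_cong, symmetric])
       (auto intro: add_closed t_closed one_closed t_distinct)
  also have "\<dots> = (\<Sum>i<q. \<chi> (t i)) * \<chi> 1"
    by (simp add: chi_add t_closed one_closed sum_distrib_right)
  finally have "(\<Sum>i<q. \<chi> (t i)) * (1 - \<chi> 1) = 0"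
    by (simp add: algebra_simps)
  then show ?thesis using chi_one by simp
qed

text \<open>Orthogonality of characters: for \<open>d\<close> outside \<open>M\<close>, primality
  makes multiplication by \<open>d\<close> injective on residue classes, so the sum is that of
  \<open>sum_chi\<close>.\<close>

lemma sum_chi_mult:
  assumes "d \<in> R"
  shows "(\<Sum>i<q. \<chi> (d * t i)) = (if d \<in> M then of_nat q else 0)"
proof (cases "d \<in> M")
  case True
  then have "\<chi> (d * t i) = 1" if "i < q" for i
    using that assms submodule_scale[OF submod, of "t i" d] t_closed
    by (auto intro!: chi_mod mult_closed simp: mult.commute)
  then show ?thesis using True by simp
next
  case False
  have "(\<Sum>i<q. \<chi> (d * t i)) = (\<Sum>i<q. \<chi> (t i))"
  proof (rule sum_reindex_mod[OF chi_cong])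
    fix i j assume ij: "i < q" "j < q" "d * t i - d * t j \<in> M"
    then have "d * (t i - t j) \<in> M" by (simp add: algebra_simps)
    then have "t i - t j \<in> M"
      using prime_mod[OF assms diff_closed[OF t_closed t_closed]] ij False by blast
    then show "i = j" using ij t_distinct by blast
  qed (auto intro: mult_closed assms t_closed)
  then show ?thesis using False sum_chi by simp
qed

text \<open>In the double sum for the squared modulus, the shift of \<open>t i\<close> by
  \<open>t j\<close> makes the exponent linear in \<open>t j\<close>. The sum over \<open>j\<close>
  then vanishes unless \<open>2 * d * t i\<close> is in \<open>M\<close>, and with \<open>2\<close>
  and \<open>d\<close> outside \<open>M\<close> only the zero class survives.\<close>

lemma cmod_gauss_sum:
  assumes d: "d \<in> R" "d \<notin> M" and two: "2 \<notin> M"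
  shows "(cmod (\<Sum>i<q. \<chi> (d * (t i)\<^sup>2)))\<^sup>2 = real q"
proof -
  have R2: "2 \<in> R" using of_nat_closed[of 2] by simp
  note cl = add_closed mult_closed power_closed diff_closed d(1) t_closed R2
  \<comment> \<open>\<open>z\<close> is the index of the representative of the zero class.\<close>
  obtain z where z: "z < q" "0 - t z \<in> M"
    using t_cover[OF zero_closed] by blast
  have tz: "t i \<in> M \<longleftrightarrow> i = z" if "i < q" for i
  proof
    assume "t i \<in> M"
    then have "t i + (0 - t z) \<in> M" using z(2) submodule_add[OF submod] by blast
    then show "i = z" using t_distinct that z(1) by simp
  next
    assume "i = z" then show "t i \<in> M" using submodule_uminus[OF submod z(2)] by simp
  qed
  have "complex_of_real ((cmod (\<Sum>i<q. \<chi> (d * (t i)\<^sup>2)))\<^sup>2)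
      = (\<Sum>i<q. \<chi> (d * (t i)\<^sup>2)) * cnj (\<Sum>i<q. \<chi> (d * (t i)\<^sup>2))"
    by (simp only: complex_norm_square)
  also have "\<dots> = (\<Sum>j<q. \<Sum>i<q. \<chi> (d * (t i)\<^sup>2) * cnj (\<chi> (d * (t j)\<^sup>2)))"
    by (simp add: cnj_sum sum_product) (rule sum.swap)
  also have "\<dots> = (\<Sum>j<q. \<Sum>i<q. \<chi> (d * (t i)\<^sup>2 - d * (t j)\<^sup>2))"
    by (intro sum.cong refl chi_mult_cnj cl) auto
  also have "\<dots> = (\<Sum>j<q. \<Sum>i<q. \<chi> (d * (t i + t j)\<^sup>2 - d * (t j)\<^sup>2))"
  proof (rule sum.cong[OF refl])
    fix j assume "j \<in> {..<q}"
    then have j: "j < q" by simp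
    show "(\<Sum>i<q. \<chi> (d * (t i)\<^sup>2 - d * (t j)\<^sup>2)) = (\<Sum>i<q. \<chi> (d * (t i + t j)\<^sup>2 - d * (t j)\<^sup>2))"
    proof (rule sum_reindex_mod[symmetric, where \<phi> = "\<lambda>x. \<chi> (d * x\<^sup>2 - d * (t j)\<^sup>2)"])
      fix x y assume xy: "x \<in> R" "y \<in> R" "x - y \<in> M"
      have "d * x\<^sup>2 - d * (t j)\<^sup>2 - (d * y\<^sup>2 - d * (t j)\<^sup>2) = (d * (x + y)) * (x - y)"
        by (simp add: algebra_simps power2_eq_square)
      moreover have "(d * (x + y)) * (x - y) \<in> M"
        using xy by (intro submodule_scale[OF submod] cl)
      ultimately show "\<chi> (d * x\<^sup>2 - d * (t j)\<^sup>2) = \<chi> (d * y\<^sup>2 - d * (t j)\<^sup>2)"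
        using xy j by (intro chi_cong cl) auto
    qed (auto intro: cl t_distinct j)
  qed
  also have "\<dots> = (\<Sum>j<q. \<Sum>i<q. \<chi> (d * (t i)\<^sup>2) * \<chi> ((2 * d * t i) * t j))"
  proof (intro sum.cong refl)
    fix i j assume "j \<in> {..<q}" "i \<in> {..<q}"
    then have ij: "i < q" "j < q" by auto
    have "d * (t i + t j)\<^sup>2 - d * (t j)\<^sup>2 = d * (t i)\<^sup>2 + (2 * d * t i) * t j"
      by (simp add: algebra_simps power2_eq_square)
    then show "\<chi> (d * (t i + t j)\<^sup>2 - d * (t j)\<^sup>2) = \<chi> (d * (t i)\<^sup>2) * \<chi> ((2 * d * t i) * t j)"
      using ij by (simp only:) (intro chi_add cl)
  qed
  also have "\<dots> = (\<Sum>i<q. \<chi> (d * (t i)\<^sup>2) * (\<Sum>j<q. \<chi> ((2 * d * t i) * t j)))"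
    by (subst sum.swap) (simp add: sum_distrib_left)
  also have "\<dots> = (\<Sum>i<q. if i = z then of_nat q else 0)"
  proof (intro sum.cong refl)
    fix i assume "i \<in> {..<q}"
    then have i: "i < q" by simp
    have "2 * d * t i \<in> M \<longleftrightarrow> i = z"
    proof
      assume "2 * d * t i \<in> M"
      then have "2 * d \<in> M \<or> t i \<in> M" using prime_mod[OF mult_closed[OF R2 d(1)] t_closed[OF i]] by blast
      moreover have "2 * d \<notin> M" using prime_mod[of 2 d] R2 d two by blast
      ultimately show "i = z" using tz i by blast
    next
      assume "i = z"
      then show "2 * d * t i \<in> M" using tz i by (intro submodule_scale[OF submod mult_closed[OF R2 d(1)]]) auto
    qed
    moreover have "\<chi> (d * (t z)\<^sup>2) = 1"
    proof (rule chi_mod)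
      have "d * t z * t z \<in> M" using tz z by (intro submodule_scale[OF submod mult_closed[OF d(1) t_closed]]) auto
      then show "d * (t z)\<^sup>2 \<in> M" by (simp add: power2_eq_square mult.assoc)
      show "d * (t z)\<^sup>2 \<in> R" using z by (intro cl)
    qed
    moreover have "2 * d * t i \<in> R" using i by (intro cl)
    ultimately show "\<chi> (d * (t i)\<^sup>2) * (\<Sum>j<q. \<chi> ((2 * d * t i) * t j)) = (if i = z then of_nat q else 0)"
      by (simp add: sum_chi_mult)
  qed
  also have "\<dots> = of_nat q" using z by simp
  finally show ?thesis by (metis of_real_eq_iff of_real_of_nat_eq)
qed

end

section \<open>The residue field of a cyclotomic ring\<close>

text \<open>The hypotheses make \<open>x\<close> an eigenvalue of an integer matrix, hence a root of
  its monic characteristic polynomial.\<close>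

lemma integer_matrix_eigenvalue_algebraic_int:
  fixes x :: complex and A :: "nat \<Rightarrow> nat \<Rightarrow> int" and v :: "nat \<Rightarrow> complex"
  assumes eq: "\<And>i. i < n \<Longrightarrow> x * v i = (\<Sum>j<n. of_int (A i j) * v j)"
    and v: "i < n" "v i \<noteq> 0"
  shows "algebraic_int x"
proof -
  let ?A = "mat n n (\<lambda>(i, j). A i j)"
  let ?B = "map_mat complex_of_int ?A"
  have A: "?A \<in> carrier_mat n n" and B: "?B \<in> carrier_mat n n" by auto
  have "eigenvector ?B (vec n v) x"
    unfolding eigenvector_def
  proof (intro conjI)
    show "vec n v \<noteq> 0\<^sub>v (dim_row ?B)"
      using v by (metis B carrier_matD(1) index_vec index_zero_vec(1))
    show "?B *\<^sub>v vec n v = x \<cdot>\<^sub>v vec n v"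
      by (rule eq_vecI) (auto simp: scalar_prod_def eq atLeast0LessThan)
  qed auto
  then have "poly (char_poly ?B) x = 0"
    using eigenvalue_root_char_poly[OF B] unfolding eigenvalue_def by blast
  then have "poly (map_poly of_int (char_poly ?A)) x = 0"
    by (simp only: of_int_hom.char_poly_hom[OF A])
  moreover have "lead_coeff (char_poly ?A) = 1"
    using degree_monic_char_poly[OF A] by simp
  ultimately show ?thesis
    unfolding algebraic_int_altdef_ipoly by blast
qed

text \<open>This is the ring \<open>\<int>[z]\<close>. Generation by differences and multiplication
  by \<open>z\<close> alone keeps the later inductions, for integrality and for the Fermat
  congruence, down to easy cases.\<close>

inductive_set adjoin_int :: "'a::comm_ring_1 \<Rightarrow> 'a set" for z where
  one: "1 \<in> adjoin_int z"
| diff: "x \<in> adjoin_int z \<Longrightarrow> y \<in> adjoin_int z \<Longrightarrow> x - y \<in> adjoin_int z"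
| scale: "x \<in> adjoin_int z \<Longrightarrow> z * x \<in> adjoin_int z"

lemma adjoin_int_subring: "comm_subring (adjoin_int z)"
proof
  fix x y assume "x \<in> adjoin_int z" "y \<in> adjoin_int z"
  from this(1) this(2) show "x * y \<in> adjoin_int z"
    by (induction) (auto simp: left_diff_distrib mult.assoc intro: adjoin_int.intros)
qed (auto intro: adjoin_int.intros)

text \<open>Multiplication by \<open>x\<close> acts on the powers \<open>z ^ 0\<close>, ...,
  \<open>z ^ (n - 1)\<close> through an integer matrix; the vector of these powers is an
  eigenvector, nonzero at index 0.\<close>

lemma adjoin_root_of_unity_algebraic_int:
  fixes z :: complex
  assumes "z ^ n = 1" "n > 0" "x \<in> adjoin_int z"
  shows "algebraic_int x"
proof -
  have "\<exists>A::nat \<Rightarrow> nat \<Rightarrow> int. \<forall>i<n. x * z ^ i = (\<Sum>j<n. of_int (A i j) * z ^ j)"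
    using assms(3)
  proof induction
    case one
    have "1 * z ^ i = (\<Sum>j<n. of_int (if j = i then 1 else 0) * z ^ j)" if "i < n" for i
    proof -
      have "(\<Sum>j<n. of_int (if j = i then 1 else 0) * z ^ j) = (\<Sum>j<n. if j = i then z ^ j else 0)"
        by (rule sum.cong) auto
      then show ?thesis using that by simp
    qed
    then show ?case by (intro exI[of _ "\<lambda>i j. if j = i then 1 else 0"]) blast
  next
    case (diff x y)
    then obtain A B :: "nat \<Rightarrow> nat \<Rightarrow> int"
      where "\<forall>i<n. x * z ^ i = (\<Sum>j<n. of_int (A i j) * z ^ j)"
        "\<forall>i<n. y * z ^ i = (\<Sum>j<n. of_int (B i j) * z ^ j)" by blast
    then show ?case
      by (intro exI[of _ "\<lambda>i j. A i j - B i j"]) (simp add: left_diff_distrib sum_subtractf)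
  next
    case (scale x)
    then obtain A :: "nat \<Rightarrow> nat \<Rightarrow> int"
      where A: "\<And>i. i < n \<Longrightarrow> x * z ^ i = (\<Sum>j<n. of_int (A i j) * z ^ j)" by blast
    \<comment> \<open>Multiplication by \<open>z\<close> shifts the rows cyclically, because
      \<open>z ^ n = 1\<close>.\<close>
    have "z * x * z ^ i = (\<Sum>j<n. of_int (A (Suc i mod n) j) * z ^ j)" if "i < n" for i
    proof -
      have "z ^ (Suc i mod n) = z ^ Suc i"
        using that assms(1) by (cases "Suc i = n") (auto simp: mod_less)
      then have "z * x * z ^ i = x * z ^ (Suc i mod n)" by simp
      then show ?thesis using A[of "Suc i mod n"] assms(2) by simp
    qed
    then show ?case
      by (intro exI[of _ "\<lambda>i j. A (Suc i mod n) j"]) simp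
  qed
  then obtain A :: "nat \<Rightarrow> nat \<Rightarrow> int"
    where "\<And>i. i < n \<Longrightarrow> x * z ^ i = (\<Sum>j<n. of_int (A i j) * z ^ j)" by blast
  then show ?thesis
    by (rule integer_matrix_eigenvalue_algebraic_int[of n x "\<lambda>i. z ^ i" A 0]) (use assms(2) in auto)
qed

text \<open>Rational algebraic integers are integers. This will show that \<open>p\<close> generates
  a proper ideal of the cyclotomic ring.\<close>

lemma inverse_prime_not_algebraic_int:
  assumes "prime (p::nat)"
  shows "\<not> algebraic_int (1 / of_nat p :: complex)"
proof
  assume "algebraic_int (1 / of_nat p :: complex)"
  moreover have "(1 / of_nat p :: complex) \<in> \<rat>" by simp
  ultimately have "(1 / of_nat p :: complex) \<in> \<int>"
    by (rule rational_algebraic_int_is_int)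
  then obtain m where "(1 / of_nat p :: complex) = of_int m" by (elim Ints_cases)
  then have "(of_int (m * int p) :: complex) = of_int 1"
    using prime_gt_0_nat[OF assms] by (simp add: field_simps)
  then have "m * int p = 1" by (simp only: of_int_eq_iff)
  then have "int p dvd 1" by (metis dvd_triv_right)
  then show False using assms by (simp add: prime_nat_iff)
qed

text \<open>Both sides are monic polynomials of degree \<open>n\<close> in \<open>x\<close> that
  agree at the \<open>n\<close> roots of unity.\<close>

lemma prod_roots_of_unity:
  fixes x :: complex
  assumes "n > 0"
  shows "x ^ n - 1 = (\<Prod>i<n. x - cis (2 * pi / n) ^ i)"
proof -
  have cis: "cis (2 * pi / n) ^ i = cis (2 * pi * real i / real n)" for i
    by (simp add: DeMoivre mult.commute)
  let ?f = "\<lambda>i. cis (2 * pi / n) ^ i"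
  let ?P = "monom 1 n - 1 :: complex poly" and ?Q = "\<Prod>i<n. [:- ?f i, 1:]"
  have bij: "bij_betw ?f {..<n} {z. z ^ n = 1}"
    using bij_betw_roots_unity[OF assms] by (simp add: cis)
  have "?P = ?Q"
  proof (rule poly_eqI_degree_lead_coeff[where n = n and A = "{z. z ^ n = 1}"])
    have dQ: "degree ?Q = n" by (subst degree_prod_eq_sum_degree) auto
    have "lead_coeff ?Q = 1" by (simp add: lead_coeff_prod)
    then show "coeff ?P n = coeff ?Q n" using dQ assms by simp
    show "n \<le> card {z::complex. z ^ n = 1}" using card_roots_unity_eq[OF assms] by simp
    show "degree ?P \<le> n" by (rule degree_diff_le) (auto simp: degree_monom_le)
    show "degree ?Q \<le> n" using dQ by simp
    fix z :: complex assume "z \<in> {z. z ^ n = 1}"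
    moreover from this obtain i where "i < n" "z = ?f i"
      using bij by (auto simp: bij_betw_def)
    moreover from this have "poly ?Q z = 0" by (auto simp: poly_prod)
    ultimately show "poly ?P z = poly ?Q z" by (simp add: poly_monom)
  qed
  then have "poly ?P x = poly ?Q x" by simp
  then show ?thesis by (simp add: poly_monom poly_prod)
qed

section \<open>Frobenius congruence and additive characters modulo a submodule\<close>

context comm_subring
begin

lemma power_mod_cong:
  assumes M: "submodule_over R M" and xy: "x \<in> R" "y \<in> R" "x - y \<in> M"
  shows "x ^ n - y ^ n \<in> M"
proof -
  have "x ^ n - y ^ n = (\<Sum>i<n. y ^ (n - Suc i) * x ^ i) * (x - y)"
    by (simp add: power_diff_sumr2 mult.commute)
  moreover have "(\<Sum>i<n. y ^ (n - Suc i) * x ^ i) \<in> R"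
    using xy by (intro sum_closed mult_closed power_closed)
  ultimately show ?thesis using submodule_scale[OF M] xy by metis
qed

text \<open>The inner binomial coefficients are divisible by \<open>p\<close>, so their terms lie in
  \<open>M\<close>.\<close>

lemma frobenius_add:
  assumes M: "submodule_over R M" and p: "prime p" "of_nat p \<in> M" and x: "x \<in> R" and y: "y \<in> R"
  shows "(x + y) ^ p - (x ^ p + y ^ p) \<in> M"
proof -
  let ?g = "\<lambda>k. of_nat (p choose k) * x ^ k * y ^ (p - k)"
  have p0: "p > 0" using p(1) prime_gt_0_nat by blast
  have "(x + y) ^ p = (\<Sum>k\<le>p. ?g k)" by (rule binomial_ring)
  also have "\<dots> = (\<Sum>k\<in>{1..<p}. ?g k) + (\<Sum>k\<in>{0, p}. ?g k)"
  proof -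
    have "{..p} = {1..<p} \<union> {0, p}" using p0 by auto
    then show ?thesis using p0 by (simp add: sum.union_disjoint)
  qed
  also have "(\<Sum>k\<in>{0, p}. ?g k) = x ^ p + y ^ p" using p0 by simp
  finally have "(x + y) ^ p - (x ^ p + y ^ p) = (\<Sum>k\<in>{1..<p}. ?g k)" by simp
  also have "\<dots> \<in> M"
  proof (rule submodule_sum[OF M])
    fix k assume "k \<in> {1..<p}"
    then have "p dvd (p choose k)" using p(1) by (intro dvd_choose_prime) auto
    then obtain c where "p choose k = p * c" by (elim dvdE)
    then have "?g k = (of_nat c * x ^ k * y ^ (p - k)) * of_nat p" by (simp add: algebra_simps)
    moreover have "of_nat c * x ^ k * y ^ (p - k) \<in> R"
      using x y by (intro mult_closed power_closed of_nat_closed)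
    ultimately show "?g k \<in> M" using submodule_scale[OF M _ p(2)] by metis
  qed
  finally show ?thesis .
qed

lemma frobenius_add_iterate:
  assumes M: "submodule_over R M" and p: "prime p" "of_nat p \<in> M" and x: "x \<in> R" and y: "y \<in> R"
  shows "(x + y) ^ (p ^ a) - (x ^ (p ^ a) + y ^ (p ^ a)) \<in> M"
proof (induction a)
  case 0 then show ?case using submodule_zero[OF M] by simp
next
  case (Suc a)
  let ?x = "x ^ (p ^ a)" and ?y = "y ^ (p ^ a)"
  have "((x + y) ^ (p ^ a)) ^ p - (?x + ?y) ^ p \<in> M"
    using Suc x y by (intro power_mod_cong[OF M] power_closed add_closed)
  moreover have "(?x + ?y) ^ p - (?x ^ p + ?y ^ p) \<in> M"
    using x y by (intro frobenius_add[OF M p] power_closed)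
  ultimately have "((x + y) ^ (p ^ a)) ^ p - (?x + ?y) ^ p
      + ((?x + ?y) ^ p - (?x ^ p + ?y ^ p)) \<in> M"
    by (rule submodule_add[OF M])
  then show ?case by (simp add: power_mult[symmetric] mult.commute) (simp add: algebra_simps)
qed

text \<open>The character is \<open>x \<mapsto> exp (2 \<pi> i c(x) / p)\<close>, where \<open>c(x)\<close> is the integer, unique modulo \<open>p\<close>,
  congruent to \<open>x\<close> modulo an additive subgroup maximal among those containing \<open>M\<close> but not 1.\<close>
lemma exists_residue_character:
  assumes M: "submodule_over R M" "1 \<notin> M" and p: "prime p" "of_nat p \<in> M"
  obtains \<chi> :: "'a \<Rightarrow> complex"
  where "\<And>x y. x \<in> R \<Longrightarrow> y \<in> R \<Longrightarrow> \<chi> (x + y) = \<chi> x * \<chi> y"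
    "\<And>x. x \<in> R \<Longrightarrow> x \<in> M \<Longrightarrow> \<chi> x = 1" "\<And>x. cmod (\<chi> x) = 1" "\<chi> 1 \<noteq> 1"
proof -
  interpret Z: comm_subring "\<int> :: 'a set" by standard auto
  have "submodule_over \<int> M"
    using M(1) of_int_closed unfolding submodule_over_def by (auto elim!: Ints_cases)
  then obtain H where H: "submodule_over \<int> H" "M \<subseteq> H" "1 \<notin> H"
    and max: "\<And>x. x \<notin> H \<Longrightarrow> \<exists>r\<in>\<int>. r * x - 1 \<in> H"
    using Z.exists_maximal_submodule[OF _ M(2)] by metis
  have p0: "p > 0" using p(1) prime_gt_0_nat by blast
  \<comment> \<open>Multiples of \<open>p\<close> annihilate \<open>R\<close> modulo
    \<open>M\<close>, hence modulo \<open>H\<close>; integer scalars therefore matter only modulo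
    \<open>p\<close>.\<close>
  have dvdH: "of_int m * x \<in> H" if m: "int p dvd m" and x: "x \<in> R" for m x
  proof -
    obtain c where "m = int p * c" using m by (elim dvdE)
    then have "of_int m * x = (of_int c * x) * of_nat p" by simp
    then show ?thesis
      using submodule_scale[OF M(1) _ p(2)] mult_closed[OF of_int_closed x] H(2) by auto
  qed
  have inv: "\<exists>m'. int p dvd m' * m - 1" if "\<not> int p dvd m" for m :: int
  proof -
    have "coprime m (int p)"
      using that p(1) by (metis coprime_commute prime_imp_coprime prime_nat_int_transfer)
    then obtain m' where "[m * m' = 1] (mod int p)"
      using cong_solve_coprime_int by blast
    then have "int p dvd m' * m - 1" by (simp add: cong_iff_dvd_diff mult.commute)
    then show ?thesis by blast
  qed
  \<comment> \<open>An integer prime to \<open>p\<close> in \<open>H\<close> could be multiplied by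
    its inverse modulo \<open>p\<close>, which would put 1 into \<open>H\<close>.\<close>
  have intH: "int p dvd m" if "of_int m \<in> H" for m
  proof (rule ccontr)
    assume "\<not> int p dvd m"
    then obtain m' where "int p dvd m' * m - 1" using inv by blast
    then have "of_int (m' * m - 1) * 1 \<in> H" using dvdH one_closed by blast
    moreover have "of_int m' * of_int m \<in> H" using submodule_scale[OF H(1)] that by simp
    ultimately have "of_int m' * of_int m - of_int (m' * m - 1) * 1 \<in> H"
      by (intro submodule_diff[OF H(1)])
    then show False using H(3) by simp
  qed
  \<comment> \<open>For \<open>x\<close> outside \<open>H\<close>, maximality gives \<open>n\<close>
    with \<open>n x\<close> congruent to 1. Such an \<open>n\<close> is prime to \<open>p\<close>,
    and its inverse modulo \<open>p\<close> is the integer congruent to \<open>x\<close>.\<close>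
  have "\<exists>m. x - of_int m \<in> H" if x: "x \<in> R" for x
  proof (cases "x \<in> H")
    case True then show ?thesis by (intro exI[of _ 0]) simp
  next
    case False
    then obtain n where n: "of_int n * x - 1 \<in> H" using max by (metis Ints_cases)
    have "\<not> int p dvd n"
    proof
      assume "int p dvd n"
      then have "of_int n * x - (of_int n * x - 1) \<in> H"
        using dvdH[OF _ x] n submodule_diff[OF H(1)] by blast
      then show False using H(3) by simp
    qed
    then obtain m where "int p dvd m * n - 1" using inv by blast
    then have "of_int m * (of_int n * x - 1) - of_int (m * n - 1) * x \<in> H"
      by (intro submodule_diff[OF H(1) submodule_scale[OF H(1) _ n] dvdH[OF _ x]]) auto
    moreover have "of_int m * (of_int n * x - 1) - of_int (m * n - 1) * x = x - of_int m"
      by (simp add: algebra_simps)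
    ultimately show ?thesis by auto
  qed
  then obtain c where c: "\<And>x. x \<in> R \<Longrightarrow> x - of_int (c x) \<in> H" by metis
  define e where "e m = cis (2 * pi * real_of_int m / real p)" for m
  have e_add: "e (m + n) = e m * e n" for m n
    by (simp add: e_def cis_mult ring_distribs add_divide_distrib)
  have e1: "e m = 1 \<longleftrightarrow> int p dvd m" for m
  proof -
    have "cis x = 1 \<longleftrightarrow> cos x = 1" for x
      by (auto simp: complex_eq_iff cos_one_sin_zero)
    then have "e m = 1 \<longleftrightarrow> (\<exists>k::int. 2 * pi * real_of_int m / real p = of_int k * 2 * pi)"
      unfolding e_def cos_one_2pi_int by blast
    also have "\<dots> \<longleftrightarrow> (\<exists>k::int. real_of_int m = real_of_int (int p * k))"
      using p0 by (simp add: field_simps)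
    also have "\<dots> \<longleftrightarrow> int p dvd m" unfolding of_int_eq_iff dvd_def ..
    finally show ?thesis .
  qed
  have e_cong: "e m = e n" if "int p dvd m - n" for m n
    using e_add[of "m - n" n] e1[of "m - n"] that by simp
  show ?thesis
  proof (rule that[of "\<lambda>x. e (c x)"])
    fix x y assume xy: "x \<in> R" "y \<in> R"
    have "(x - of_int (c x)) + (y - of_int (c y)) - (x + y - of_int (c (x + y))) \<in> H"
      by (intro submodule_diff[OF H(1) submodule_add[OF H(1)]] c add_closed xy)
    moreover have "(x - of_int (c x)) + (y - of_int (c y)) - (x + y - of_int (c (x + y)))
        = of_int (c (x + y) - (c x + c y))" by simp
    ultimately have "int p dvd c (x + y) - (c x + c y)" using intH by metis
    then show "e (c (x + y)) = e (c x) * e (c y)" using e_cong e_add by metis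
  next
    fix x assume x: "x \<in> R" "x \<in> M"
    then have "x - (x - of_int (c x)) \<in> H" using H(2) by (intro submodule_diff[OF H(1) _ c]) auto
    then show "e (c x) = 1" using intH e1 by simp
  next
    show "cmod (e (c x)) = 1" for x by (simp add: e_def)
  next
    show "e (c 1) \<noteq> 1"
    proof
      assume "e (c 1) = 1"
      then have "of_int (c 1) * 1 \<in> H" using e1 dvdH one_closed by blast
      then have "(1 - of_int (c 1)) + of_int (c 1) * 1 \<in> H"
        using c[OF one_closed] by (intro submodule_add[OF H(1)])
      then show False using H(3) by simp
    qed
  qed
qed

end

section \<open>Powers of a root of unity as residue representatives\<close>

text \<open>The zero class gets the last index \<open>q - 1\<close>; the nonzero classes are powers
  of one generator, so that squares become even powers.\<close>

lemma exists_cyclotomic_residue_character: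
  fixes p a :: nat
  assumes p: "prime p" and odd: "odd q" and q: "q = p ^ a" "q > 1"
    and z_def: "z = cis (2 * pi / (q - 1))"
  obtains M \<chi> where "residue_character (adjoin_int z) M (\<lambda>i. if i < q - 1 then z ^ i else 0) q \<chi>"
    "2 \<notin> M"
proof -
  define n where "n = q - 1"
  have n: "n > 0" "q = Suc n" "even n" using q odd by (auto simp: n_def)
  have z: "z = cis (2 * pi / n)" by (simp add: z_def n_def)
  have zn: "z ^ n = 1" using n(1) by (simp add: z DeMoivre)
  let ?R = "adjoin_int z"
  interpret comm_subring ?R by (rule adjoin_int_subring)
  have zR: "z \<in> ?R" using adjoin_int.scale[OF adjoin_int.one] by simp
  let ?I = "(\<lambda>r. r * of_nat p) ` ?R"
  have "submodule_over ?R ?I"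
    unfolding submodule_over_def
    by (auto simp: mult.assoc[symmetric] left_diff_distrib[symmetric] intro: mult_closed diff_closed)
       (auto intro!: image_eqI[of _ _ 0] zero_closed)
  moreover have "1 \<notin> ?I"
  proof
    assume "1 \<in> ?I"
    then obtain r where "r \<in> ?R" "1 = r * of_nat p" by blast
    moreover from this have "r = 1 / of_nat p" using p by (auto simp: field_simps)
    ultimately have "1 / of_nat p \<in> ?R" by simp
    then show False
      using adjoin_root_of_unity_algebraic_int[OF zn n(1)] inverse_prime_not_algebraic_int[OF p] by blast
  qed
  ultimately obtain M where M: "submodule_over ?R M" "?I \<subseteq> M" "1 \<notin> M"
    and inv: "\<And>x. x \<notin> M \<Longrightarrow> \<exists>r\<in>?R. r * x - 1 \<in> M"
    using exists_maximal_submodule by metis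
  have pM: "of_nat p \<in> M" using M(2) one_closed by force
  have qM: "of_nat q \<in> M"
  proof -
    have "a > 0" using q by (cases a) auto
    then have "of_nat q = of_nat (p ^ (a - 1)) * (of_nat p :: complex)"
      by (metis Suc_diff_1 of_nat_mult power_Suc2 q(1))
    then show ?thesis using submodule_scale[OF M(1) of_nat_closed pM] by metis
  qed
  \<comment> \<open>With \<open>r\<close> an inverse of \<open>y\<close> modulo \<open>M\<close>,
    the element \<open>x\<close> is \<open>r * (x * y)\<close> minus a multiple of
    \<open>r * y - 1\<close>.\<close>
  have prime_mod: "x \<in> M \<or> y \<in> M" if "x \<in> ?R" "y \<in> ?R" "x * y \<in> M" for x y
  proof (rule disjCI)
    assume "y \<notin> M"
    then obtain r where r: "r \<in> ?R" "r * y - 1 \<in> M" using inv by blast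
    then have "r * (x * y) - x * (r * y - 1) \<in> M"
      using that by (intro submodule_diff[OF M(1) submodule_scale[OF M(1)] submodule_scale[OF M(1)]])
    moreover have "r * (x * y) - x * (r * y - 1) = x" by (simp add: algebra_simps)
    ultimately show "x \<in> M" by simp
  qed
  \<comment> \<open>The congruence passes to differences by Frobenius and oddness of
    \<open>q\<close>, and to multiples by \<open>z\<close> because \<open>z ^ q = z\<close>.\<close>
  have fermat: "x ^ q - x \<in> M" if "x \<in> ?R" for x
    using that
  proof induction
    case one then show ?case using submodule_zero[OF M(1)] by simp
  next
    case (diff x y)
    have "(x + (- y)) ^ q - (x ^ q + (- y) ^ q) \<in> M"
      unfolding q(1) using diff by (intro frobenius_add_iterate[OF M(1) p pM] uminus_closed)
    then have "((x + (- y)) ^ q - (x ^ q + (- y) ^ q)) + ((x ^ q - x) - (y ^ q - y)) \<in> M"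
      using diff by (intro submodule_add[OF M(1) _ submodule_diff[OF M(1)]])
    then show ?case using odd by (simp add: power_minus_odd algebra_simps)
  next
    case (scale x)
    have "(z * x) ^ q - z * x = z * (x ^ q - x)"
      using zn n(2) by (simp add: power_mult_distrib algebra_simps)
    then show ?case using scale zR submodule_scale[OF M(1)] by metis
  qed
  let ?t = "\<lambda>i. if i < q - 1 then z ^ i else 0"
  have unit: "x \<in> M" if "i \<le> n" "x \<in> ?R" "z ^ i * x \<in> M" for i x
  proof -
    have "z ^ (n - i) * (z ^ i * x) \<in> M"
      by (rule submodule_scale[OF M(1) power_closed[OF zR] that(3)])
    moreover have "z ^ (n - i) * (z ^ i * x) = x"
      using that(1) zn by (simp add: mult.assoc[symmetric] power_add[symmetric])
    ultimately show ?thesis by simp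
  qed
  \<comment> \<open>Since \<open>z ^ d\<close> is an \<open>n\<close>-th root of unity other than 1,
    its geometric sum over \<open>n\<close> terms is 0. If it were 1 modulo \<open>M\<close>, that
    sum would be congruent to \<open>n\<close>, so \<open>n\<close> and then
    \<open>q - n = 1\<close> would lie in \<open>M\<close>.\<close>
  have order: False if "0 < d" "d < n" "z ^ d - 1 \<in> M" for d
  proof -
    have "inj_on (\<lambda>k. cis (2 * pi * real k / real n)) {..<n}"
      using bij_betw_roots_unity[OF n(1)] by (simp add: bij_betw_def)
    then have "cis (2 * pi * real d / real n) \<noteq> cis (2 * pi * real 0 / real n)"
      using that n(1) by (subst inj_on_eq_iff) auto
    then have "z ^ d \<noteq> 1"
      by (simp add: z DeMoivre mult.commute)
    moreover have "(z ^ d) ^ n = 1"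
      using zn by (metis mult.commute power_mult power_one)
    ultimately have "(\<Sum>j<n. (z ^ d) ^ j) = 0"
      by (simp add: geometric_sum)
    moreover have "(\<Sum>j<n. (z ^ d) ^ j - 1 ^ j) \<in> M"
      using that(3) zR by (intro submodule_sum[OF M(1)] power_mod_cong[OF M(1)] power_closed one_closed)
    ultimately have "- of_nat n \<in> M" by (simp add: sum_subtractf)
    then have "of_nat q + (- of_nat n) \<in> M" using submodule_add[OF M(1) qM] by blast
    then show False using M(3) n(2) by simp
  qed
  \<comment> \<open>Both signs of the difference are allowed, so that one statement excludes
    \<open>i < j\<close> and, after swapping, \<open>j < i\<close>.\<close>
  have distinct: "\<not> i < j" if "j < q" "?t i - ?t j \<in> M \<or> ?t j - ?t i \<in> M" for i j
  proof
    assume ij: "i < j"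
    have mem: "?t j - ?t i \<in> M" using that(2) submodule_uminus[OF M(1)] by (metis minus_diff_eq)
    show False
    proof (cases "j = n")
      case True
      then have "z ^ i * 1 \<in> M" using ij submodule_uminus[OF M(1) mem] by (simp add: n_def)
      then show False using unit[of i 1] M(3) one_closed ij that n by auto
    next
      case False
      then have j: "j < n" using that n by simp
      then have "z ^ j - z ^ i \<in> M" using mem ij n by simp
      moreover have "z ^ j - z ^ i = z ^ i * (z ^ (j - i) - 1)"
        using ij by (simp add: algebra_simps power_add[symmetric])
      ultimately have "z ^ (j - i) - 1 \<in> M"
        using unit[of i "z ^ (j - i) - 1"] ij j zR by (auto intro: diff_closed power_closed one_closed)
      then show False using order[of "j - i"] ij j by linarith
    qed
  qed
  \<comment> \<open>\<open>x ^ q - x\<close> is the product of \<open>x\<close> and all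
    \<open>x - z ^ i\<close>; by primality some factor lies in \<open>M\<close>.\<close>
  have cover: "\<exists>i<q. x - ?t i \<in> M" if x: "x \<in> ?R" for x
  proof -
    have prod: "(\<Prod>i\<in>A. x - z ^ i) \<in> M \<Longrightarrow> \<exists>i\<in>A. x - z ^ i \<in> M" if "finite A" for A
      using that
    proof induction
      case empty then show ?case using M(3) by simp
    next
      case (insert i A)
      have "(\<Prod>i\<in>A. x - z ^ i) \<in> ?R"
        using insert(1) by induction (auto intro!: one_closed mult_closed diff_closed power_closed x zR)
      moreover have "x - z ^ i \<in> ?R" by (intro diff_closed power_closed x zR)
      ultimately show ?case using insert prime_mod by auto
    qed
    have "x ^ q - x = x * (x ^ n - 1)" by (simp add: n(2) algebra_simps)
    then have "x * (x ^ n - 1) \<in> M" using fermat[OF x] by simp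
    then consider "x \<in> M" | "x ^ n - 1 \<in> M"
      using prime_mod x by (blast intro: diff_closed power_closed one_closed)
    then show ?thesis
    proof cases
      case 1 then show ?thesis using n(2) by (intro exI[of _ n]) simp
    next
      case 2
      then have "(\<Prod>i<n. x - z ^ i) \<in> M" using prod_roots_of_unity[OF n(1)] z by simp
      then obtain i where "i < n" "x - z ^ i \<in> M" using prod by blast
      then show ?thesis using n by (intro exI[of _ i]) simp
    qed
  qed
  obtain \<chi> where \<chi>: "\<And>x y. x \<in> ?R \<Longrightarrow> y \<in> ?R \<Longrightarrow> \<chi> (x + y) = \<chi> x * \<chi> y"
    "\<And>x. x \<in> ?R \<Longrightarrow> x \<in> M \<Longrightarrow> \<chi> x = 1" "\<And>x. cmod (\<chi> x) = 1" "\<chi> 1 \<noteq> 1"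
    using exists_residue_character[OF M(1) M(3) p pM] by metis
  have "residue_character ?R M ?t q \<chi>"
  proof unfold_locales
    show "\<exists>i<q. x - ?t i \<in> M" if "x \<in> ?R" for x using cover that by blast
    show "i = j" if "i < q" "j < q" "?t i - ?t j \<in> M" for i j
      using distinct[of j i] distinct[of i j] that by linarith
  qed (use M(1) prime_mod \<chi> zR in \<open>auto intro: power_closed zero_closed\<close>)
  moreover have "2 \<notin> M"
  proof
    assume "2 \<in> M"
    obtain m where "n = 2 * m" using n(3) by (elim evenE)
    then have "of_nat q - of_nat m * 2 \<in> M"
      using \<open>2 \<in> M\<close> qM by (intro submodule_diff[OF M(1)] submodule_scale[OF M(1)] of_nat_closed)
    then show False using M(3) n \<open>n = 2 * m\<close> by simp
  qed
  ultimately show ?thesis using that by blast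
qed

section \<open>The frame\<close>

text \<open>The hypothesis says that the coordinate rows of the frame matrix are orthonormal.
  Summing over the frame index first leaves only the diagonal terms of the expanded squares.\<close>

lemma parseval_frameI:
  assumes "\<And>j l. j < r \<Longrightarrow> l < r \<Longrightarrow> (\<Sum>i<N. f i l * cnj (f i j)) = (if j = l then 1 else 0)"
  shows "parseval_frame N r f"
  unfolding parseval_frame_def
proof
  fix x
  have "complex_of_real (\<Sum>i<N. (cmod (cinner r x (f i)))\<^sup>2)
      = (\<Sum>i<N. cinner r x (f i) * cnj (cinner r x (f i)))"
    by (simp add: complex_norm_square[symmetric])
  also have "\<dots> = (\<Sum>i<N. \<Sum>j<r. \<Sum>l<r. (x j * cnj (x l)) * (f i l * cnj (f i j)))"
    by (simp add: cinner_def cnj_sum sum_product algebra_simps)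
  also have "\<dots> = (\<Sum>j<r. \<Sum>i<N. \<Sum>l<r. (x j * cnj (x l)) * (f i l * cnj (f i j)))"
    by (rule sum.swap)
  also have "\<dots> = (\<Sum>j<r. \<Sum>l<r. \<Sum>i<N. (x j * cnj (x l)) * (f i l * cnj (f i j)))"
    by (rule sum.cong[OF refl], rule sum.swap)
  also have "\<dots> = (\<Sum>j<r. \<Sum>l<r. if j = l then x j * cnj (x l) else 0)"
    by (intro sum.cong refl) (simp add: sum_distrib_left[symmetric] assms)
  also have "\<dots> = (\<Sum>j<r. x j * cnj (x j))" by simp
  also have "\<dots> = complex_of_real ((cvnorm r x)\<^sup>2)"
    by (simp add: cvnorm_def sum_nonneg complex_norm_square[symmetric])
  finally show "(\<Sum>i<N. (cmod (cinner r x (f i)))\<^sup>2) = (cvnorm r x)\<^sup>2"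
    by (simp only: of_real_eq_iff)
qed

text \<open>\<open>s\<close> lists the nonzero squares. The hypothesis \<open>squares\<close>
  expresses a multiset identity: squaring the representatives gives 0 once and each
  \<open>s j\<close> twice.\<close>

lemma (in residue_character) CETF_of_squares:
  assumes q: "q = 2 * m + 1" and two: "2 \<notin> M"
    and s: "\<And>j. j < m \<Longrightarrow> s j \<in> R"
    and s_distinct: "\<And>i j. i < m \<Longrightarrow> j < m \<Longrightarrow> s i - s j \<in> M \<Longrightarrow> i = j"
    and s_nonzero: "\<And>j. j < m \<Longrightarrow> s j \<notin> M"
    and squares: "\<And>\<phi>::'a \<Rightarrow> complex. (\<Sum>i<q. \<phi> ((t i)\<^sup>2)) = \<phi> 0 + 2 * (\<Sum>j<m. \<phi> (s j))"
  shows "\<exists>f. CETF (2 * Suc m) (Suc m) f"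
proof -
  \<comment> \<open>The rows have norm 1 because \<open>q * a * a + c * c = 1\<close> and
    \<open>q * b * b = 1\<close>; the vectors have equal norms because
    \<open>a * a + m * b * b = c * c = 1 / 2\<close>.\<close>
  define a b c where "a = complex_of_real (1 / sqrt (2 * q))"
    and "b = complex_of_real (1 / sqrt q)" and "c = complex_of_real (1 / sqrt 2)"
  have q0: "q > 0" using q by simp
  have sq: "a * a = 1 / (2 * of_nat q)" "b * b = 1 / of_nat q" "c * c = 1 / 2"
    unfolding a_def b_def c_def of_real_mult[symmetric] by simp_all
  have cnj: "cnj a = a" "cnj b = b" "cnj c = c" by (simp_all add: a_def b_def c_def)
  \<comment> \<open>Coordinate 0 is the constant one and coordinate \<open>Suc j\<close> belongs to
    the square \<open>s j\<close>; the frame index \<open>q\<close> is the extra vector.\<close>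
  define f where "f i j = (if i < q then (if j = 0 then a else b * \<chi> (t i * s (j - 1)))
    else (if j = 0 then c else 0))" for i j
  have N: "2 * Suc m = Suc q" using q by simp
  have ts: "t i * s j \<in> R" if "i < q" "j < m" for i j
    using that by (intro mult_closed t_closed s)
  have bchi: "b * \<chi> x * cnj (b * \<chi> y) = b * b * \<chi> (x - y)" if "x \<in> R" "y \<in> R" for x y
    using chi_mult_cnj[OF that] by (simp add: cnj mult.assoc mult.left_commute[of "\<chi> x"])
  have sum_s: "(\<Sum>i<q. \<chi> (t i * s j)) = 0" if "j < m" for j
    using sum_chi_mult[OF s[OF that]] s_nonzero[OF that] by (simp add: mult.commute)
  have parseval: "parseval_frame (2 * Suc m) (Suc m) f"
  proof (rule parseval_frameI)
    fix j l assume jl: "j < Suc m" "l < Suc m"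
    show "(\<Sum>i<2 * Suc m. f i l * cnj (f i j)) = (if j = l then 1 else 0)"
    proof (cases j; cases l)
      assume "j = 0" "l = 0"
      then show ?thesis unfolding N using q0 by (simp add: f_def sq cnj)
    next
      fix l' assume "j = 0" "l = Suc l'"
      moreover from this have "(\<Sum>i<q. b * \<chi> (t i * s l') * a) = 0"
        using sum_s[of l'] jl by (simp flip: sum_distrib_left sum_distrib_right)
      ultimately show ?thesis unfolding N by (simp add: f_def cnj)
    next
      fix j' assume "j = Suc j'" "l = 0"
      moreover from this have "(\<Sum>i<q. a * (b * cnj (\<chi> (t i * s j')))) = 0"
        using sum_s[of j'] jl by (simp flip: sum_distrib_left cnj_sum)
      ultimately show ?thesis unfolding N by (simp add: f_def cnj)
    next
      fix j' l' assume eq: "j = Suc j'" "l = Suc l'"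
      then have j': "j' < m" "l' < m" using jl by auto
      have "(\<Sum>i<2 * Suc m. f i l * cnj (f i j)) = (\<Sum>i<q. b * b * \<chi> ((s l' - s j') * t i))"
        unfolding N using eq j' by (simp add: f_def bchi ts del: complex_cnj_mult) (simp add: algebra_simps)
      also have "\<dots> = b * b * (if s l' - s j' \<in> M then of_nat q else 0)"
        by (simp only: sum_distrib_left[symmetric] sum_chi_mult[OF diff_closed[OF s s]] j')
      also have "s l' - s j' \<in> M \<longleftrightarrow> j = l"
        using s_distinct[OF j'(2,1)] eq submodule_zero[OF submod] by auto
      finally show ?thesis using q0 by (simp add: sq)
    qed
  qed
  have norms: "cvnorm (Suc m) (f i) = sqrt (1 / 2)" if "i < 2 * Suc m" for i
  proof (cases "i < q")
    case True
    have "(\<Sum>j<Suc m. (cmod (f i j))\<^sup>2) = (cmod a)\<^sup>2 + (\<Sum>j<m. (cmod b)\<^sup>2)"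
      using True by (simp only: sum.lessThan_Suc_shift)
        (simp add: f_def norm_mult cmod_chi ts)
    also have "\<dots> = 1 / 2"
      using q0 by (simp add: a_def b_def norm_divide power_divide) (simp add: q field_simps)
    finally show ?thesis by (simp add: cvnorm_def)
  next
    case False
    then have "(\<Sum>j<Suc m. (cmod (f i j))\<^sup>2) = 1 / 2"
      by (simp only: sum.lessThan_Suc_shift) (simp add: f_def c_def norm_divide power_divide)
    then show ?thesis by (simp add: cvnorm_def)
  qed
  have angles: "cmod (cinner (Suc m) (f i) (f l)) = 1 / (2 * sqrt q)"
    if il: "i < 2 * Suc m" "l < 2 * Suc m" "i \<noteq> l" for i l
  proof -
    have expand: "cinner (Suc m) (f i) (f l) = f i 0 * cnj (f l 0) + (\<Sum>j<m. f i (Suc j) * cnj (f l (Suc j)))"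
      by (simp only: cinner_def sum.lessThan_Suc_shift)
    \<comment> \<open>This is the modulus for pairs with the extra vector; the Gauss sum must give
      the same value for all other pairs.\<close>
    have ac: "cmod (a * c) = 1 / (2 * sqrt q)"
      by (simp add: a_def c_def norm_mult norm_divide real_sqrt_mult)
    consider "i < q" "l < q" | "i < q" "l = q" | "i = q" "l < q"
      using il N by linarith
    then show ?thesis
    proof cases
      case 1
      let ?d = "t i - t l"
      have d: "?d \<in> R" "?d \<notin> M" using 1 il t_distinct t_closed diff_closed by auto
      have "(\<Sum>j<m. f i (Suc j) * cnj (f l (Suc j))) = (\<Sum>j<m. b * b * \<chi> (?d * s j))"
        using 1 by (simp add: f_def bchi ts del: complex_cnj_mult) (simp add: left_diff_distrib)
      then have "cinner (Suc m) (f i) (f l) = a * a + b * b * (\<Sum>j<m. \<chi> (?d * s j))"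
        using 1 by (simp only: expand) (simp add: f_def cnj sum_distrib_left)
      \<comment> \<open>As \<open>b * b\<close> is twice \<open>a * a\<close>, the coefficients 1
        and 2 match those in \<open>squares\<close>, and the half sum completes to a Gauss
        sum.\<close>
      also have "\<dots> = (1 + 2 * (\<Sum>j<m. \<chi> (?d * s j))) / (2 * of_nat q)"
        using q0 by (simp add: sq field_simps)
      also have "1 + 2 * (\<Sum>j<m. \<chi> (?d * s j)) = (\<Sum>u<q. \<chi> (?d * (t u)\<^sup>2))"
        using squares[of "\<lambda>x. \<chi> (?d * x)"] by (simp add: chi_zero)
      finally have "cmod (cinner (Suc m) (f i) (f l)) = cmod (\<Sum>u<q. \<chi> (?d * (t u)\<^sup>2)) / (2 * q)"
        by (simp add: norm_divide norm_mult)
      also have "cmod (\<Sum>u<q. \<chi> (?d * (t u)\<^sup>2)) = sqrt q"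
        using cmod_gauss_sum[OF d two] by (metis norm_ge_zero real_sqrt_unique)
      also have "sqrt q / (2 * q) = 1 / (2 * sqrt q)"
        using q0 by (simp add: field_simps)
      finally show ?thesis .
    next
      case 2
      then show ?thesis unfolding expand using ac by (simp add: f_def cnj)
    next
      case 3
      then show ?thesis unfolding expand using ac by (simp add: f_def cnj mult.commute)
    qed
  qed
  show ?thesis
    unfolding CETF_def using parseval norms angles by blast
qed

theorem theorem6:
  fixes k :: nat
  assumes "k \<ge> 3"
    and "\<exists>p \<alpha>::nat. prime p \<and> 2 * k = p ^ \<alpha> + 1 \<and> (2 * k) mod 4 = 2"
  shows "\<exists>f. CETF (2 * k) k f"
proof -
  obtain p \<alpha> :: nat where p: "prime p" and k: "2 * k = p ^ \<alpha> + 1"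
    using assms(2) by blast
  define m q where "m = k - 1" and "q = p ^ \<alpha>"
  have m: "k = Suc m" "m > 0" using assms(1) by (auto simp: m_def)
  have q: "q = 2 * m + 1" using k m by (simp add: q_def)
  define z where "z = cis (2 * pi / (q - 1))"
  have "odd q" "q > 1" using q m by auto
  then obtain M \<chi>
    where chi: "residue_character (adjoin_int z) M (\<lambda>i. if i < q - 1 then z ^ i else 0) q \<chi>"
      and M: "2 \<notin> M"
    by (rule exists_cyclotomic_residue_character[OF p _ q_def _ z_def])
  interpret residue_character "adjoin_int z" M "\<lambda>i. if i < q - 1 then z ^ i else 0" q \<chi>
    by (rule chi)
  let ?t = "\<lambda>i. if i < q - 1 then z ^ i else 0"
  have zm: "z ^ (2 * m) = 1" using m(2) by (simp add: z_def q DeMoivre)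
  have "\<exists>f. CETF (2 * Suc m) (Suc m) f"
  proof (rule CETF_of_squares[where s = "\<lambda>j. z ^ (2 * j)", OF q M])
    fix i j assume "i < m" "j < m" "z ^ (2 * i) - z ^ (2 * j) \<in> M"
    then show "i = j" using t_distinct[of "2 * i" "2 * j"] q by simp
  next
    fix j assume "j < m"
    then show "z ^ (2 * j) \<in> adjoin_int z" using t_closed[of "2 * j"] q by simp
    \<comment> \<open>Index \<open>2 * m = q - 1\<close> carries the representative 0, so
      distinctness from it is nonmembership in \<open>M\<close>.\<close>
    show "z ^ (2 * j) \<notin> M" using t_distinct[of "2 * j" "2 * m"] \<open>j < m\<close> q by auto
  next
    fix \<phi> :: "complex \<Rightarrow> complex"
    have "(\<Sum>i<q. \<phi> ((?t i)\<^sup>2)) = \<phi> 0 + (\<Sum>i<m + m. \<phi> (z ^ (2 * i)))"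
      by (simp add: q power_mult[symmetric] mult.commute flip: mult_2)
    \<comment> \<open>Because \<open>z ^ (2 * m) = 1\<close>, the second half of the even powers
      repeats the first: every nonzero square has two roots.\<close>
    also have "(\<Sum>i<m + m. \<phi> (z ^ (2 * i))) = (\<Sum>i<m. \<phi> (z ^ (2 * i))) + (\<Sum>i<m. \<phi> (z ^ (2 * (i + m))))"
      by (simp add: sum.nat_group lessThan_atLeast0 sum.atLeastLessThan_concat[of 0 m "m + m", symmetric]
          sum.shift_bounds_nat_ivl[of _ 0 m m, simplified])
    also have "\<dots> = 2 * (\<Sum>j<m. \<phi> (z ^ (2 * j)))"
      by (simp add: zm power_add distrib_left)
    finally show "(\<Sum>i<q. \<phi> ((?t i)\<^sup>2)) = \<phi> 0 + 2 * (\<Sum>j<m. \<phi> (z ^ (2 * j)))" .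
  qed
  then show ?thesis using m by simp
qed

end
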